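(* Let $n\ge 2$ and let $c\in\mathbb R$ with $c\neq 0$. Every bounded real-valued eigenfunction $u$ of $-\Delta$ (so $u\not\equiv 0$) with $$-\Delta u=c^2u\quad\text{on }\mathbb R^n$$ must change sign near $\infty$.
   Context: The equation is understood in the weak (distributional) sense, and an eigenfunction is by definition not identically zero. "$u$ changes sign near $\infty$" means that there is no $R'>0$ such that $u\ge 0$ on $\{|x|>R'\}$ or $u\le 0$ on $\{|x|>R'\}$. *)

theory Defs
  imports "HOL-Analysis.Analysis"
begin

definition partial_deriv :: "'a::euclidean_space \<Rightarrow> ('a \<Rightarrow> real) \<Rightarrow> 'a \<Rightarrow> real" where
  "partial_deriv b f x = frechet_derivative f (at x) b"

definition laplacian :: "('a::euclidean_space \<Rightarrow> real) \<Rightarrow> 'a \<Rightarrow> real" where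
  "laplacian f x = (\<Sum>b\<in>Basis. partial_deriv b (partial_deriv b f) x)"

fun C_k :: "nat \<Rightarrow> ('a::euclidean_space \<Rightarrow> real) \<Rightarrow> bool" where
  "C_k 0 f \<longleftrightarrow> continuous_on UNIV f"
| "C_k (Suc k) f \<longleftrightarrow> f differentiable_on UNIV \<and> (\<forall>b\<in>Basis. C_k k (partial_deriv b f))"

definition test_function :: "('a::euclidean_space \<Rightarrow> real) \<Rightarrow> bool" where
  "test_function \<phi> \<longleftrightarrow> (\<forall>k. C_k k \<phi>) \<and> compact (closure {x. \<phi> x \<noteq> 0})"

definition locally_integrable :: "('a::euclidean_space \<Rightarrow> real) \<Rightarrow> bool" where
  "locally_integrable u \<longleftrightarrow> (\<forall>K. compact K \<longrightarrow> set_integrable lebesgue K u)"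

definition weak_eigenfunction :: "real \<Rightarrow> ('a::euclidean_space \<Rightarrow> real) \<Rightarrow> bool"
  \<comment> \<open>u solves \<open>- laplacian u = \<mu> u\<close> in the sense of distributions on the whole space.
    A weak solution is determined only up to a null set, so the requirement that it is not
    identically zero has to be read modulo null sets.\<close>
  where
  "weak_eigenfunction \<mu> u \<longleftrightarrow>
     locally_integrable u \<and>
     \<not> (AE x in lebesgue. u x = 0) \<and>
     (\<forall>\<phi>. test_function \<phi> \<longrightarrow>
        (LINT x|lebesgue. u x * (- laplacian \<phi> x)) = \<mu> * (LINT x|lebesgue. u x * \<phi> x))"

definition essentially_bounded :: "('a::euclidean_space \<Rightarrow> real) \<Rightarrow> bool" where
  "essentially_bounded u \<longleftrightarrow> (\<exists>M. AE x in lebesgue. \<bar>u x\<bar> \<le> M)"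

definition changes_sign_near_infinity :: "('a::euclidean_space \<Rightarrow> real) \<Rightarrow> bool"
  \<comment> \<open>The sign conditions are also modulo null sets, so that the notion does not depend on the
    chosen representative; for continuous u it agrees with the pointwise one.\<close>
  where
  "changes_sign_near_infinity u \<longleftrightarrow>
     \<not> (\<exists>R>0. (AE x in lebesgue. norm x > R \<longrightarrow> u x \<ge> 0) \<or>
              (AE x in lebesgue. norm x > R \<longrightarrow> u x \<le> 0))"

end

theory Submission
  imports Defs
begin

text \<open>
  A solution \<open>u\<close> of \<open>- \<Delta> u = c\<^sup>2 u\<close> that has a sign near infinity is shown to vanish almost everywhere,
  in two steps, both of which test the equation against an explicit family of functions.

  Near infinity. On a large ball the Dirichlet Laplacian has first eigenvalue below \<open>c\<^sup>2\<close>, so there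
  ought to be a strict subsolution there: a smooth bump \<open>\<phi>\<close>, supported in the ball, with
  \<open>\<Delta> \<phi> + c\<^sup>2 \<phi> > 0\<close> inside it. An explicit one is the radial bump
  \<open>exp (- 1 / t)\<close> with \<open>t = 1 - \<bar>x - a\<bar>\<^sup>2 / L\<^sup>2\<close>, once \<open>L\<close> is large: near the
  boundary its convex, rapidly growing radial profile wins, and away from the boundary
  \<open>\<Delta> \<phi> / \<phi>\<close> is of order \<open>1 / L\<^sup>2\<close> (\<open>subsolution_bump\<close>). If the ball lies where \<open>u \<ge> 0\<close>,
  then \<open>\<integral> u (\<Delta> \<phi> + c\<^sup>2 \<phi>) = 0\<close> has a nonnegative integrand and forces \<open>u = 0\<close> on the ball. Such balls
  cover a neighbourhood of infinity (\<open>nonneg_near_infinity_imp_vanishes\<close>).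

  Compact support. Now \<open>u\<close> may be paired with any smooth function, in particular with the real
  exponentials \<open>exp (\<xi> \<bullet> x)\<close>, for which \<open>\<Delta>\<close> is multiplication by \<open>\<bar>\<xi>\<bar>\<^sup>2\<close>. Hence
  \<open>(\<bar>\<xi>\<bar>\<^sup>2 + c\<^sup>2) \<integral> u exp (\<xi> \<bullet> x) = 0\<close>, and the first factor is positive (\<open>integral_exp_eq_0\<close>). By
  the Stone-Weierstrass theorem the span of the exponentials is dense in the continuous functions on
  a ball, so \<open>u\<close> is orthogonal to all of them and vanishes (\<open>exp_moments_zero_imp_AE_zero\<close>).

  The case \<open>u \<le> 0\<close> near infinity follows by passing to \<open>- u\<close>.
\<close>

section \<open>Calculus of smooth functions\<close>

definition smooth :: "('a::euclidean_space \<Rightarrow> real) \<Rightarrow> bool" where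
  "smooth f \<longleftrightarrow> (\<forall>k. C_k k f)"

lemma partial_deriv_eq:
  assumes "(f has_derivative D) (at x)"
  shows "partial_deriv b f x = D b"
  using frechet_derivative_at[OF assms] by (simp add: partial_deriv_def)

lemma differentiable_frechet:
  "f differentiable at x \<Longrightarrow> (f has_derivative frechet_derivative f (at x)) (at x)"
  by (simp add: frechet_derivative_works)

lemma partial_deriv_add:
  assumes "f differentiable at x" "g differentiable at x"
  shows "partial_deriv b (\<lambda>x. f x + g x) x = partial_deriv b f x + partial_deriv b g x"
  by (rule trans[OF partial_deriv_eq[OF has_derivative_add[OF assms[THEN differentiable_frechet]]]])
     (simp add: partial_deriv_def)

lemma partial_deriv_mult:
  fixes f g :: "'a::euclidean_space \<Rightarrow> real"
  assumes "f differentiable at x" "g differentiable at x"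
  shows "partial_deriv b (\<lambda>x. f x * g x) x = f x * partial_deriv b g x + partial_deriv b f x * g x"
  by (rule trans[OF partial_deriv_eq[OF has_derivative_mult[OF assms[THEN differentiable_frechet]]]])
     (simp add: partial_deriv_def)

lemma partial_deriv_const [simp]: "partial_deriv b (\<lambda>x. c) = (\<lambda>x. 0)"
  by (rule ext) (simp add: partial_deriv_def)

lemma partial_deriv_inner [simp]: "partial_deriv b (\<lambda>x. \<xi> \<bullet> x) = (\<lambda>x. \<xi> \<bullet> b)"
  by (rule ext, rule partial_deriv_eq) (auto intro!: derivative_eq_intros)

lemma partial_deriv_chain:
  assumes "(F has_real_derivative F') (at (q x))" "q differentiable at x"
  shows "((\<lambda>x. F (q x)) has_derivative (\<lambda>v. F' * frechet_derivative q (at x) v)) (at x)"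
    and "partial_deriv b (\<lambda>x. F (q x)) x = F' * partial_deriv b q x"
proof -
  show *: "((\<lambda>x. F (q x)) has_derivative (\<lambda>v. F' * frechet_derivative q (at x) v)) (at x)"
    using has_derivative_compose[OF differentiable_frechet[OF assms(2)], of F "(*) F'"] assms(1)
    by (simp add: has_field_derivative_def)
  show "partial_deriv b (\<lambda>x. F (q x)) x = F' * partial_deriv b q x"
    using partial_deriv_eq[OF *] by (simp add: partial_deriv_def)
qed

lemma partial_deriv_local:
  assumes "open U" "x \<in> U" "\<And>y. y \<in> U \<Longrightarrow> f y = g y" "f differentiable at x"
  shows "partial_deriv b f x = partial_deriv b g x"
  using frechet_derivative_transform_within_open[OF assms(4,1,2,3)] by (simp add: partial_deriv_def)

lemma C_k_Suc_differentiable: "C_k (Suc k) f \<Longrightarrow> f differentiable at x"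
  by (simp add: differentiable_on_def)

lemma C_k_mono_Suc: "C_k (Suc k) f \<Longrightarrow> C_k k f"
proof (induction k arbitrary: f)
  case 0
  then show ?case by (simp add: differentiable_imp_continuous_on)
qed auto

lemma C_k_const: "C_k k (\<lambda>x. c)"
  by (induction k arbitrary: c) auto

lemma C_k_inner: "C_k k (\<lambda>x. \<xi> \<bullet> x)"
  by (cases k) (auto intro!: continuous_intros derivative_intros C_k_const
      bounded_linear_imp_differentiable_on bounded_linear_inner_right)

lemma C_k_add: "C_k k f \<Longrightarrow> C_k k g \<Longrightarrow> C_k k (\<lambda>x. f x + g x)"
proof (induction k arbitrary: f g)
  case 0
  then show ?case by (auto intro: continuous_intros)
next
  case (Suc k)
  note d = Suc.prems[THEN C_k_Suc_differentiable]
  have "partial_deriv b (\<lambda>x. f x + g x) = (\<lambda>x. partial_deriv b f x + partial_deriv b g x)" for b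
    using d by (intro ext partial_deriv_add)
  then show ?case
    using Suc by (auto intro: derivative_intros)
qed

lemma C_k_mult: "C_k k f \<Longrightarrow> C_k k g \<Longrightarrow> C_k k (\<lambda>x. f x * g x)"
proof (induction k arbitrary: f g)
  case 0
  then show ?case by (auto intro: continuous_intros)
next
  case (Suc k)
  note d = Suc.prems[THEN C_k_Suc_differentiable]
  have "partial_deriv b (\<lambda>x. f x * g x) = (\<lambda>x. f x * partial_deriv b g x + partial_deriv b f x * g x)" for b
    using d by (intro ext partial_deriv_mult)
  then show ?case
    using Suc C_k_mono_Suc[OF Suc.prems(1)] C_k_mono_Suc[OF Suc.prems(2)]
    by (auto intro!: derivative_intros C_k_add)
qed

lemma smooth_const: "smooth (\<lambda>x. c)"
  and smooth_inner: "smooth (\<lambda>x. \<xi> \<bullet> x)"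
  and smooth_add: "smooth f \<Longrightarrow> smooth g \<Longrightarrow> smooth (\<lambda>x. f x + g x)"
  and smooth_mult: "smooth f \<Longrightarrow> smooth g \<Longrightarrow> smooth (\<lambda>x. f x * g x)"
  by (auto simp: smooth_def intro: C_k_const C_k_inner C_k_add C_k_mult)

lemma smooth_diff: "smooth f \<Longrightarrow> smooth g \<Longrightarrow> smooth (\<lambda>x. f x - g x)"
  using smooth_add[OF _ smooth_mult[OF smooth_const[of "-1"]], of f g] by simp

lemma smooth_differentiable: "smooth f \<Longrightarrow> f differentiable at x"
  unfolding smooth_def using C_k_Suc_differentiable by blast

lemma smooth_continuous: "smooth f \<Longrightarrow> continuous_on S f"
  unfolding smooth_def using continuous_on_subset by (metis C_k.simps(1) subset_UNIV)

lemma smooth_partial_deriv: "smooth f \<Longrightarrow> b \<in> Basis \<Longrightarrow> smooth (partial_deriv b f)"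
  unfolding smooth_def by (metis C_k.simps(2))

lemma smooth_laplacian_continuous:
  assumes "smooth f"
  shows "continuous_on S (laplacian f)"
  unfolding laplacian_def[abs_def]
  by (intro continuous_on_sum smooth_continuous smooth_partial_deriv assms)

lemma smooth_sum: "(\<And>i. i \<in> I \<Longrightarrow> smooth (f i)) \<Longrightarrow> smooth (\<lambda>x. \<Sum>i\<in>I. f i x)"
  by (induction I rule: infinite_finite_induct) (auto intro: smooth_const smooth_add)

lemma smooth_norm_sq: "smooth (\<lambda>x::'a::euclidean_space. (norm (x - a))\<^sup>2)"
proof -
  have "(\<lambda>x. (norm (x - a))\<^sup>2) = (\<lambda>x. \<Sum>b\<in>Basis. (b \<bullet> x - b \<bullet> a) * (b \<bullet> x - b \<bullet> a))"
    by (rule ext, subst power2_norm_eq_inner, subst euclidean_inner)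
       (simp add: inner_diff_right inner_commute)
  then show ?thesis
    by (simp add: smooth_sum smooth_mult smooth_diff smooth_inner smooth_const)
qed

text \<open>
  The outer function comes with the whole sequence \<open>D\<close> of its derivatives, since differentiating
  \<open>D m \<circ> q\<close> produces \<open>D (Suc m) \<circ> q\<close> times a smooth factor: the claim for all \<open>m\<close> at once is what the
  induction on the order of smoothness needs.
\<close>
lemma smooth_compose:
  assumes D: "\<And>m t. (D m has_real_derivative D (Suc m) t) (at t)" and q: "smooth q"
  shows "smooth (\<lambda>x. D m (q x))"
proof -
  have d: "((\<lambda>x. D m (q x)) has_derivative (\<lambda>v. D (Suc m) (q x) * frechet_derivative q (at x) v)) (at x)"
    for m x
    by (rule partial_deriv_chain(1)[OF D smooth_differentiable[OF q]])
  have "C_k k (\<lambda>x. D m (q x))" for k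
  proof (induction k arbitrary: m)
    case 0
    show ?case
      using d[of m] by (auto intro!: continuous_at_imp_continuous_on has_derivative_continuous)
  next
    case (Suc k)
    have "partial_deriv b (\<lambda>x. D m (q x)) = (\<lambda>x. D (Suc m) (q x) * partial_deriv b q x)" for b
      using partial_deriv_chain(2)[OF D smooth_differentiable[OF q]] by blast
    moreover have "(\<lambda>x. D m (q x)) differentiable_on UNIV"
      using d[of m] by (auto simp: differentiable_on_def differentiable_def)
    moreover have "C_k k (partial_deriv b q)" if "b \<in> Basis" for b
      using smooth_partial_deriv[OF q that] by (simp add: smooth_def)
    ultimately show ?case
      using Suc by (auto intro: C_k_mult)
  qed
  then show ?thesis by (simp add: smooth_def)
qed

lemma laplacian_compose:
  assumes D: "\<And>m t. (D m has_real_derivative D (Suc m) t) (at t)" and q: "smooth q"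
  shows "laplacian (\<lambda>x. D m (q x)) x =
    D (Suc (Suc m)) (q x) * (\<Sum>b\<in>Basis. (partial_deriv b q x)\<^sup>2) + D (Suc m) (q x) * laplacian q x"
proof -
  have 1: "partial_deriv b (\<lambda>x. D m (q x)) = (\<lambda>x. D (Suc m) (q x) * partial_deriv b q x)" for b m
    using partial_deriv_chain(2)[OF D smooth_differentiable[OF q]] by blast
  have "partial_deriv b (partial_deriv b (\<lambda>x. D m (q x))) x =
      D (Suc (Suc m)) (q x) * (partial_deriv b q x)\<^sup>2
        + D (Suc m) (q x) * partial_deriv b (partial_deriv b q) x" if "b \<in> Basis" for b
    unfolding 1 using that
    by (subst partial_deriv_mult)
       (auto simp: 1 power2_eq_square algebra_simps
          intro!: smooth_differentiable smooth_compose[of D] D q smooth_partial_deriv)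
  then show ?thesis
    by (simp add: laplacian_def sum.distrib sum_distrib_left)
qed

section \<open>The flat function and its derivatives\<close>

text \<open>
  The \<open>m\<close>-th derivative of \<open>exp (- 1 / t)\<close> for \<open>t > 0\<close> is a polynomial in \<open>y = 1 / t\<close> times
  \<open>exp (- y)\<close>; as \<open>y' = - y\<^sup>2\<close>, differentiating \<open>p(y) exp (- y)\<close> gives
  \<open>y\<^sup>2 (p(y) - p'(y)) exp (- y)\<close>.
\<close>
primrec flat_poly :: "nat \<Rightarrow> real poly" where
  "flat_poly 0 = 1"
| "flat_poly (Suc m) = [:0, 0, 1:] * (flat_poly m - pderiv (flat_poly m))"

definition flat :: "nat \<Rightarrow> real \<Rightarrow> real" where
  "flat m t = (if t \<le> 0 then 0 else poly (flat_poly m) (1 / t) * exp (- (1 / t)))"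

lemma poly_mult_exp_minus_tendsto_0:
  fixes p :: "real poly"
  shows "((\<lambda>y. poly p y * exp (- y)) \<longlongrightarrow> 0) at_top"
proof -
  have "((\<lambda>y. \<Sum>i\<le>degree p. coeff p i * (y ^ i / exp y)) \<longlongrightarrow> (\<Sum>i\<le>degree p. coeff p i * 0)) at_top"
    by (intro tendsto_intros tendsto_power_div_exp_0)
  then show ?thesis
    by (simp add: poly_altdef sum_distrib_right exp_minus divide_inverse mult.assoc)
qed

text \<open>
  Only \<open>t = 0\<close> needs an argument: there the difference quotient from the right is again a
  polynomial in \<open>1 / h\<close> times \<open>exp (- 1 / h)\<close>, which tends to \<open>0\<close>.
\<close>
lemma flat_has_derivative: "(flat m has_real_derivative flat (Suc m) t) (at t)"
proof -
  consider "t < 0" | "t > 0" | "t = 0" by linarith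
  then show ?thesis
  proof cases
    case 1
    have "((\<lambda>t. 0) has_real_derivative 0) (at t)" by simp
    then have "(flat m has_real_derivative 0) (at t)"
      by (rule has_field_derivative_transform_within_open[of _ _ _ "{..<0}"]) (use 1 in \<open>auto simp: flat_def\<close>)
    then show ?thesis using 1 by (simp add: flat_def)
  next
    case 2
    have "((\<lambda>t. poly (flat_poly m) (1 / t) * exp (- (1 / t))) has_real_derivative flat (Suc m) t) (at t)"
      using 2 by (auto intro!: derivative_eq_intros poly_DERIV[THEN DERIV_chain2] simp: flat_def)
        (simp add: field_simps)
    then show ?thesis
      by (rule has_field_derivative_transform_within_open[of _ _ _ "{0<..}"]) (use 2 in \<open>auto simp: flat_def\<close>)
  next
    case 3
    have "((\<lambda>h. poly (pCons 0 (flat_poly m)) (inverse h) * exp (- inverse h)) \<longlongrightarrow> 0) (at_right 0)"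
      by (rule filterlim_compose[OF poly_mult_exp_minus_tendsto_0 filterlim_inverse_at_top_right])
    then have r: "((\<lambda>h. (flat m (0 + h) - flat m 0) / h) \<longlongrightarrow> 0) (at_right 0)"
      by (rule Lim_transform_eventually)
         (auto simp: flat_def eventually_at_filter field_simps)
    have l: "((\<lambda>h. (flat m (0 + h) - flat m 0) / h) \<longlongrightarrow> 0) (at_left 0)"
      by (rule tendsto_eventually) (auto simp: flat_def eventually_at_filter)
    have "((\<lambda>h. (flat m (0 + h) - flat m 0) / h) \<longlongrightarrow> 0) (at 0)"
      using l r by (rule filterlim_split_at)
    then show ?thesis using 3 by (simp add: DERIV_def flat_def)
  qed
qed

lemma flat_values:
  "t \<le> 0 \<Longrightarrow> flat m t = 0"
  "t > 0 \<Longrightarrow> flat 0 t = exp (- (1 / t))"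
  "t > 0 \<Longrightarrow> flat (Suc 0) t = exp (- (1 / t)) / t ^ 2"
  "t > 0 \<Longrightarrow> flat 2 t = exp (- (1 / t)) * (1 - 2 * t) / t ^ 4"
  by (auto simp: flat_def numeral_2_eq_2 pderiv_mult pderiv_pCons field_simps power2_eq_square power4_eq_xxxx)

section \<open>Bumps that are strict subsolutions\<close>

lemma partial_deriv_norm_sq:
  "partial_deriv b (\<lambda>x. (norm (x - a))\<^sup>2) = (\<lambda>x. 2 * (b \<bullet> x) + 2 * - (b \<bullet> a))"
proof
  fix x
  have "((\<lambda>x. (x - a) \<bullet> (x - a)) has_derivative (\<lambda>v. 2 * (v \<bullet> (x - a)))) (at x)"
    by (auto intro!: derivative_eq_intros simp: inner_commute)
  from partial_deriv_eq[OF this, of b]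
  show "partial_deriv b (\<lambda>x. (norm (x - a))\<^sup>2) x = 2 * (b \<bullet> x) + 2 * - (b \<bullet> a)"
    by (simp add: power2_norm_eq_inner inner_diff_right)
qed

lemma partial_deriv_cmult:
  "f differentiable at x \<Longrightarrow> partial_deriv b (\<lambda>x. k * f x) x = k * partial_deriv b f x"
  by (simp add: partial_deriv_mult)

lemma sum_inner_Basis_sq:
  fixes y :: "'a::euclidean_space"
  shows "(\<Sum>b\<in>Basis. (b \<bullet> y)\<^sup>2) = (norm y)\<^sup>2"
  unfolding power2_norm_eq_inner
  by (subst euclidean_inner) (simp add: inner_commute power2_eq_square)

lemma laplacian_bump:
  fixes a :: "'a::euclidean_space" and k l :: real
  defines "t \<equiv> \<lambda>x. k - l * (norm (x - a))\<^sup>2"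
  shows "laplacian (\<lambda>x. flat 0 (t x)) x =
    flat 2 (t x) * (4 * l * (k - t x)) - flat 1 (t x) * (2 * l * DIM('a))"
proof -
  have t_eq: "t = (\<lambda>x. k + (- l) * (norm (x - a))\<^sup>2)"
    by (simp add: t_def)
  have t: "smooth t"
    unfolding t_eq by (intro smooth_add smooth_mult smooth_const smooth_norm_sq)
  have 1: "partial_deriv b t = (\<lambda>x. (- l) * (2 * (b \<bullet> x) + 2 * - (b \<bullet> a)))" for b
    unfolding t_eq
    by (rule ext, subst partial_deriv_add, simp, intro smooth_differentiable smooth_mult smooth_const smooth_norm_sq)
       (subst partial_deriv_cmult, intro smooth_differentiable smooth_norm_sq, simp add: partial_deriv_norm_sq)
  have 2: "partial_deriv b (partial_deriv b t) x = - 2 * l" if "b \<in> Basis" for b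
    unfolding 1 using that
    by (subst partial_deriv_cmult, intro smooth_differentiable smooth_add smooth_mult smooth_const smooth_inner)
       (subst partial_deriv_add partial_deriv_cmult,
        (intro smooth_differentiable smooth_add smooth_mult smooth_const smooth_inner)+, simp)+
  have "(\<Sum>b\<in>Basis. (partial_deriv b t x)\<^sup>2) = (\<Sum>b\<in>Basis. 4 * l\<^sup>2 * (b \<bullet> (x - a))\<^sup>2)"
    unfolding 1 by (intro sum.cong) (auto simp: power2_eq_square inner_diff_right algebra_simps)
  also have "\<dots> = 4 * l * (k - t x)"
    unfolding sum_distrib_left[symmetric] sum_inner_Basis_sq by (simp add: t_def power2_eq_square)
  finally show ?thesis
    using laplacian_compose[of flat, OF flat_has_derivative t, of 0 x]
    by (simp add: laplacian_def[of t] 2 numeral_2_eq_2)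
qed

text \<open>
  This is \<open>\<Delta> \<phi> + c\<^sup>2 \<phi> > 0\<close> for the bump, divided by its positive factors, where \<open>N\<close> is the dimension.
  For small \<open>t\<close>, that is near the boundary of the support, the constant term \<open>4\<close> dominates. Otherwise
  \<open>t\<close> is at least \<open>1 / (N + 6)\<close>, and the coefficient of \<open>t ^ 4\<close> is chosen so that the last term
  exceeds \<open>12 + 2 * N\<close>, which bounds everything negative.
\<close>
lemma bump_inequality:
  fixes N t :: real
  assumes "0 \<le> N" "0 < t" "t \<le> 1"
  shows "0 < 4 * (1 - t) * (1 - 2 * t) - 2 * N * t\<^sup>2 + (12 + 2 * N) * (N + 6) ^ 4 * t ^ 4"
proof (cases "(N + 6) * t \<le> 1")
  case True
  then have "N * t + 6 * t \<le> 1" "0 \<le> N * t"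
    using assms by (auto simp: algebra_simps)
  then have "6 * t \<le> 1" "N * t \<le> 1" using assms by linarith+
  have "N * t * t \<le> 1 * t"
    using \<open>N * t \<le> 1\<close> assms by (intro mult_right_mono) auto
  moreover have "0 \<le> (12 + 2 * N) * (N + 6) ^ 4 * t ^ 4"
    using assms by simp
  moreover have "4 * (1 - t) * (1 - 2 * t) = 4 - 12 * t + 8 * t\<^sup>2"
    by (simp add: power2_eq_square algebra_simps)
  moreover have "0 \<le> t\<^sup>2" by simp
  ultimately show ?thesis
    using \<open>6 * t \<le> 1\<close> by (simp only: power2_eq_square mult.assoc)
next
  case False
  then have "1 < ((N + 6) * t) ^ 4"
    by (intro one_less_power) auto
  then have "(12 + 2 * N) * 1 < (12 + 2 * N) * ((N + 6) * t) ^ 4"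
    using assms by (intro mult_strict_left_mono) auto
  then have "12 + 2 * N < (12 + 2 * N) * (N + 6) ^ 4 * t ^ 4"
    by (simp add: power_mult_distrib mult.assoc)
  moreover have "N * t\<^sup>2 \<le> N * 1"
    using assms by (intro mult_left_mono power_le_one) auto
  moreover have "4 * (1 - t) * (1 - 2 * t) = 4 - 12 * t + 8 * t\<^sup>2"
    by (simp add: power2_eq_square algebra_simps)
  moreover have "0 \<le> t\<^sup>2" by simp
  ultimately show ?thesis using assms by linarith
qed

lemma test_functionI:
  assumes "smooth \<phi>" "\<And>x. r < norm (x - a) \<Longrightarrow> \<phi> x = 0"
  shows "test_function \<phi>"
proof -
  have "{x. \<phi> x \<noteq> 0} \<subseteq> cball a r"
    using assms(2) by (force simp: dist_norm norm_minus_commute)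
  then have "bounded {x. \<phi> x \<noteq> 0}"
    by (rule bounded_subset[OF bounded_cball])
  then show ?thesis
    using assms(1) by (simp add: test_function_def smooth_def compact_closure)
qed

text \<open>
  The radius \<open>L\<close> does not depend on the centre. It is chosen through \<open>l = 1 / L\<^sup>2\<close> so that
  \<open>c\<^sup>2 / l\<close> is the coefficient of \<open>t ^ 4\<close> in \<open>bump_inequality\<close>.
\<close>
lemma subsolution_bump:
  fixes c :: real
  assumes "c \<noteq> 0"
  shows "\<exists>L>0. \<forall>a::'a::euclidean_space. \<exists>\<phi>. smooth \<phi> \<and>
    (\<forall>x. L \<le> norm (x - a) \<longrightarrow> \<phi> x = 0 \<and> laplacian \<phi> x = 0) \<and>
    (\<forall>x. norm (x - a) < L \<longrightarrow> 0 < laplacian \<phi> x + c\<^sup>2 * \<phi> x)"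
proof -
  define N where "N = real DIM('a)"
  define K where "K = (12 + 2 * N) * (N + 6) ^ 4"
  have "0 < K" by (simp add: K_def N_def add_pos_nonneg)
  define l where "l = c\<^sup>2 / K"
  define L where "L = 1 / sqrt l"
  have l: "0 < l" using assms \<open>0 < K\<close> by (simp add: l_def)
  then have L: "0 < L" "l * L\<^sup>2 = 1" by (auto simp: L_def power_divide)
  have out: "1 - l * s\<^sup>2 \<le> 0" if "L \<le> s" for s
    using mult_left_mono[OF power_mono[OF that, of 2], of l] l L by simp
  have ins: "0 < 1 - l * s\<^sup>2" if "0 \<le> s" "s < L" for s
    using mult_strict_left_mono[OF power_strict_mono[OF that(2,1), of 2], of l] l L by simp
  show ?thesis
  proof (intro exI[of _ L] conjI L(1) allI)
    fix a :: 'a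
    define t where "t = (\<lambda>x. 1 - l * (norm (x - a))\<^sup>2)"
    define \<phi> where "\<phi> = (\<lambda>x. flat 0 (t x))"
    have t: "smooth t"
      unfolding t_def by (intro smooth_diff smooth_mult smooth_const smooth_norm_sq)
    have lap: "laplacian \<phi> x = flat 2 (t x) * (4 * l * (1 - t x)) - flat 1 (t x) * (2 * l * N)" for x
      unfolding \<phi>_def t_def N_def by (rule laplacian_bump)
    have "smooth \<phi>"
      unfolding \<phi>_def by (rule smooth_compose[of flat, OF flat_has_derivative t])
    moreover have "\<phi> x = 0 \<and> laplacian \<phi> x = 0" if "L \<le> norm (x - a)" for x
      using out[OF that] unfolding lap by (simp add: \<phi>_def t_def flat_values)
    moreover have "0 < laplacian \<phi> x + c\<^sup>2 * \<phi> x" if "norm (x - a) < L" for x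
    proof -
      have tx: "0 < t x" "t x \<le> 1"
        using ins[OF norm_ge_zero that] l by (auto simp: t_def)
      have c: "c\<^sup>2 = l * K" using \<open>0 < K\<close> by (simp add: l_def)
      define E where "E = exp (- (1 / t x)) / t x ^ 4"
      have "t x ^ 4 = (t x)\<^sup>2 * (t x)\<^sup>2" by (simp flip: power_add)
      then have E: "\<phi> x = E * t x ^ 4" "flat 1 (t x) = E * (t x)\<^sup>2" "flat 2 (t x) = E * (1 - 2 * t x)"
        using tx by (auto simp: E_def \<phi>_def flat_values divide_simps)
      have "laplacian \<phi> x + c\<^sup>2 * \<phi> x = l * E *
          (4 * (1 - t x) * (1 - 2 * t x) - 2 * N * (t x)\<^sup>2 + K * t x ^ 4)"
        unfolding lap c E by (simp add: algebra_simps)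
      also have "\<dots> > 0"
        using bump_inequality[of N "t x"] tx l by (intro mult_pos_pos) (auto simp: E_def K_def N_def)
      finally show ?thesis .
    qed
    ultimately show "\<exists>\<phi>. smooth \<phi> \<and> (\<forall>x. L \<le> norm (x - a) \<longrightarrow> \<phi> x = 0 \<and> laplacian \<phi> x = 0) \<and>
       (\<forall>x. norm (x - a) < L \<longrightarrow> 0 < laplacian \<phi> x + c\<^sup>2 * \<phi> x)" by blast
  qed
qed

section \<open>Solutions with a sign near infinity vanish there\<close>

lemma locally_integrable_measurable:
  fixes u :: "'a::euclidean_space \<Rightarrow> real"
  assumes "locally_integrable u"
  shows "u \<in> borel_measurable lebesgue"
proof (rule borel_measurable_LIMSEQ_real)
  fix i :: nat
  show "(\<lambda>x. indicator (cball 0 (real i)) x * u x) \<in> borel_measurable lebesgue"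
    using assms unfolding locally_integrable_def set_integrable_def
    by (auto intro!: borel_measurable_integrable simp flip: real_scaleR_def)
next
  fix x :: 'a
  obtain n :: nat where "norm x \<le> n" using real_arch_simple by blast
  then have "indicator (cball 0 (real i)) x * u x = u x" if "n \<le> i" for i
    using that by (auto simp: indicator_def)
  then show "(\<lambda>i. indicator (cball 0 (real i)) x * u x) \<longlonglongrightarrow> u x"
    by (intro tendsto_eventually) (auto simp: eventually_sequentially)
qed

text \<open>
  A locally integrable function may be multiplied by any function bounded on the compact set outside
  of which the product vanishes. The vanishing is asked of the product so that it can come from either
  factor: from the test function, or from \<open>u\<close> once it is known to have compact support.
\<close>
lemma integrable_mult_bounded_support:
  fixes u g :: "'a::euclidean_space \<Rightarrow> real"
  assumes u: "locally_integrable u" and g: "g \<in> borel_measurable lebesgue"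
    and K: "compact K" "\<And>x. x \<in> K \<Longrightarrow> \<bar>g x\<bar> \<le> B" and out: "AE x in lebesgue. x \<notin> K \<longrightarrow> u x * g x = 0"
  shows "integrable lebesgue (\<lambda>x. u x * g x)"
proof (rule Bochner_Integration.integrable_bound)
  show "integrable lebesgue (\<lambda>x. B * (indicator K x * u x))"
    using u K by (auto simp: locally_integrable_def set_integrable_def)
  show "(\<lambda>x. u x * g x) \<in> borel_measurable lebesgue"
    using locally_integrable_measurable[OF u] g by measurable
  have "\<bar>u x * g x\<bar> \<le> \<bar>B * (indicator K x * u x)\<bar>" if "x \<notin> K \<longrightarrow> u x * g x = 0" for x
  proof (cases "x \<in> K")
    case True
    then have "\<bar>g x\<bar> \<le> \<bar>B\<bar>" using K(2) by fastforce
    then have "\<bar>g x\<bar> * \<bar>u x\<bar> \<le> \<bar>B\<bar> * \<bar>u x\<bar>" by (rule mult_right_mono) simp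
    then show ?thesis using True by (simp add: abs_mult mult.commute)
  qed (use that in auto)
  then show "AE x in lebesgue. norm (u x * g x) \<le> norm (B * (indicator K x * u x))"
    using out by (auto elim!: AE_mp)
qed

lemma continuous_measurable_lebesgue:
  fixes g :: "'a::euclidean_space \<Rightarrow> real"
  shows "continuous_on UNIV g \<Longrightarrow> g \<in> borel_measurable lebesgue"
  by (intro measurable_completion) (simp add: borel_measurable_continuous_onI)

lemma integrable_mult_continuous:
  fixes u g :: "'a::euclidean_space \<Rightarrow> real"
  assumes u: "locally_integrable u" and g: "continuous_on UNIV g"
    and K: "compact K" and out: "AE x in lebesgue. x \<notin> K \<longrightarrow> u x * g x = 0"
  shows "integrable lebesgue (\<lambda>x. u x * g x)"
proof -
  have "bounded (g ` K)"
    using K continuous_on_subset[OF g] by (intro compact_imp_bounded compact_continuous_image) auto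
  then obtain B where "\<And>x. x \<in> K \<Longrightarrow> \<bar>g x\<bar> \<le> B" by (auto simp: bounded_iff)
  then show ?thesis
    by (rule integrable_mult_bounded_support[OF u continuous_measurable_lebesgue[OF g] K _ out])
qed

text \<open>
  Testing against the subsolution bump on any ball inside the region where \<open>u \<ge> 0\<close> gives \<open>u = 0\<close>
  almost everywhere on that ball. The balls are uncountably many, but a set that is locally null is
  null.
\<close>
lemma nonneg_near_infinity_imp_vanishes:
  fixes u :: "'a::euclidean_space \<Rightarrow> real"
  assumes "c \<noteq> 0" and u: "locally_integrable u"
    and weak: "\<And>\<phi>. test_function \<phi> \<Longrightarrow>
        (LINT x|lebesgue. u x * (- laplacian \<phi> x)) = c\<^sup>2 * (LINT x|lebesgue. u x * \<phi> x)"
    and R: "0 < R" "AE x in lebesgue. norm x > R \<longrightarrow> u x \<ge> 0"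
  obtains \<rho> where "0 < \<rho>" "AE x in lebesgue. norm x > \<rho> \<longrightarrow> u x = 0"
proof -
  obtain L where "0 < L" and bump:
    "\<forall>a::'a::euclidean_space. \<exists>\<phi>. smooth \<phi> \<and>
      (\<forall>x. L \<le> norm (x - a) \<longrightarrow> \<phi> x = 0 \<and> laplacian \<phi> x = 0) \<and>
      (\<forall>x. norm (x - a) < L \<longrightarrow> 0 < laplacian \<phi> x + c\<^sup>2 * \<phi> x)"
    using subsolution_bump[OF \<open>c \<noteq> 0\<close>, where 'a = 'a] by auto
  have null: "AE x in lebesgue. norm (x - a) < L \<longrightarrow> u x = 0" if a: "R + L < norm a" for a
  proof -
    obtain \<phi> where \<phi>: "smooth \<phi>"
      and out: "\<And>x. L \<le> norm (x - a) \<Longrightarrow> \<phi> x = 0 \<and> laplacian \<phi> x = 0"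
      and ins: "\<And>x. norm (x - a) < L \<Longrightarrow> 0 < laplacian \<phi> x + c\<^sup>2 * \<phi> x"
      using spec[OF bump, of a] by auto
    have outside: "x \<notin> cball a L \<Longrightarrow> \<phi> x = 0 \<and> laplacian \<phi> x = 0" for x
      using out[of x] by (simp add: dist_norm norm_minus_commute)
    have i1: "integrable lebesgue (\<lambda>x. u x * \<phi> x)"
      by (rule integrable_mult_continuous[OF u smooth_continuous[OF \<phi>] compact_cball[of a L]])
         (use outside in auto)
    have i2: "integrable lebesgue (\<lambda>x. u x * laplacian \<phi> x)"
      by (rule integrable_mult_continuous[OF u smooth_laplacian_continuous[OF \<phi>] compact_cball[of a L]])
         (use outside in auto)
    have "test_function \<phi>"
      by (rule test_functionI[OF \<phi>, of L a]) (use out in auto)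
    from weak[OF this]
    have "(LINT x|lebesgue. u x * laplacian \<phi> x + c\<^sup>2 * (u x * \<phi> x)) = 0"
      using i1 i2 by simp
    moreover have "AE x in lebesgue. 0 \<le> u x * laplacian \<phi> x + c\<^sup>2 * (u x * \<phi> x)"
      using R(2)
    proof eventually_elim
      case (elim x)
      show ?case
      proof (cases "norm (x - a) < L")
        case True
        then have "R < norm x" using norm_triangle_ineq2[of a "a - x"] a by (simp add: norm_minus_commute)
        then have "0 \<le> u x * (laplacian \<phi> x + c\<^sup>2 * \<phi> x)"
          using ins[OF True] elim by (intro mult_nonneg_nonneg) auto
        then show ?thesis by (simp add: algebra_simps)
      qed (use out in auto)
    qed
    ultimately have "AE x in lebesgue. u x * laplacian \<phi> x + c\<^sup>2 * (u x * \<phi> x) = 0"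
      using integral_nonneg_eq_0_iff_AE[of lebesgue "\<lambda>x. u x * laplacian \<phi> x + c\<^sup>2 * (u x * \<phi> x)"]
        i1 i2 by simp
    then show ?thesis
    proof eventually_elim
      case (elim x)
      then have "u x * (laplacian \<phi> x + c\<^sup>2 * \<phi> x) = 0" by (simp add: algebra_simps)
      then show ?case using ins[of x] by auto
    qed
  qed
  define S where "S = {x. R + L < norm x \<and> u x \<noteq> 0}"
  have "negligible S"
    unfolding locally_negligible_alt[of S]
  proof
    fix x assume "x \<in> S"
    then have "AE y in lebesgue. norm (y - x) < L \<longrightarrow> u y = 0" using null by (auto simp: S_def)
    then obtain N where "negligible N" "{y. \<not> (norm (y - x) < L \<longrightarrow> u y = 0)} \<subseteq> N"
      by (auto simp: eventually_ae_filter_negligible)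
    then have "negligible (S \<inter> ball x L)"
      by (elim negligible_subset) (auto simp: S_def dist_norm norm_minus_commute)
    then show "\<exists>U. openin (top_of_set S) U \<and> x \<in> U \<and> negligible U"
      using \<open>x \<in> S\<close> \<open>0 < L\<close> by (intro exI[of _ "S \<inter> ball x L"]) (auto intro: openin_open_Int)
  qed
  then have "AE x in lebesgue. norm x > R + L \<longrightarrow> u x = 0"
    by (auto simp: eventually_ae_filter_negligible S_def)
  then show ?thesis using that[of "R + L"] \<open>0 < R\<close> \<open>0 < L\<close> by simp
qed

section \<open>Pairing a compactly supported solution with exponentials\<close>

lemma laplacian_local:
  assumes "open U" "x \<in> U" "\<And>y. y \<in> U \<Longrightarrow> f y = g y" "smooth f"
  shows "laplacian f x = laplacian g x"
proof -
  have "partial_deriv b (partial_deriv b f) x = partial_deriv b (partial_deriv b g) x" if "b \<in> Basis" for b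
    by (rule partial_deriv_local[OF assms(1,2) partial_deriv_local[OF assms(1) _ assms(3)]])
       (auto intro: smooth_differentiable smooth_partial_deriv assms that)
  then show ?thesis by (simp add: laplacian_def)
qed

lemma smooth_exp_inner: "smooth (\<lambda>x. exp (\<xi> \<bullet> x))"
  by (rule smooth_compose[of "\<lambda>_. exp"]) (auto intro: smooth_inner)

lemma laplacian_exp_inner: "laplacian (\<lambda>x. exp (\<xi> \<bullet> x)) x = (norm \<xi>)\<^sup>2 * exp (\<xi> \<bullet> x)"
  by (subst laplacian_compose[of "\<lambda>_. exp"])
     (auto intro: smooth_inner simp: laplacian_def sum_inner_Basis_sq[symmetric] inner_commute)

text \<open>
  The flat function \<open>f\<close> yields a cutoff without any division: \<open>f (\<bar>x\<bar>\<^sup>2 - \<rho>\<^sup>2)\<close> vanishes on the ball of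
  radius \<open>\<rho>\<close> and is at least \<open>1 / 2\<close> far out, so \<open>w = 1 - 2 f (\<bar>x\<bar>\<^sup>2 - \<rho>\<^sup>2)\<close> is \<open>1\<close> on the ball and
  at most \<open>0\<close> far out. Hence \<open>f \<circ> w\<close> is zero far out and equal to \<open>f 1 = exp (- 1)\<close> on the ball,
  which the factor \<open>exp 1\<close> normalizes.
\<close>
lemma smooth_cutoff:
  fixes \<rho> :: real
  obtains \<zeta> :: "'a::euclidean_space \<Rightarrow> real" and r where "smooth \<zeta>"
    "\<And>x. norm x \<le> \<rho> \<Longrightarrow> \<zeta> x = 1" "\<And>x. r < norm x \<Longrightarrow> \<zeta> x = 0"
proof -
  define w where "w = (\<lambda>x::'a. 1 - 2 * flat 0 ((norm (x - 0))\<^sup>2 - \<rho>\<^sup>2))"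
  have "smooth w"
    unfolding w_def
    by (intro smooth_diff smooth_mult smooth_const smooth_compose[of flat] flat_has_derivative smooth_norm_sq)
  then have "smooth (\<lambda>x. exp 1 * flat 0 (w x))"
    by (intro smooth_mult smooth_const smooth_compose[of flat] flat_has_derivative)
  moreover have "exp 1 * flat 0 (w x) = 1" if "norm x \<le> \<rho>" for x
    using power_mono[OF that, of 2] by (simp add: w_def flat_values exp_minus)
  moreover have "exp 1 * flat 0 (w x) = 0" if "sqrt (\<rho>\<^sup>2 + 2) < norm x" for x
  proof -
    have "(sqrt (\<rho>\<^sup>2 + 2))\<^sup>2 < (norm x)\<^sup>2" using that by (intro power_strict_mono) auto
    then have s: "2 < (norm x)\<^sup>2 - \<rho>\<^sup>2" by simp
    then have "1 / ((norm x)\<^sup>2 - \<rho>\<^sup>2) \<le> 1 / 2" by (simp add: divide_simps)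
    moreover have "1 + - (1 / ((norm x)\<^sup>2 - \<rho>\<^sup>2)) \<le> exp (- (1 / ((norm x)\<^sup>2 - \<rho>\<^sup>2)))"
      by (rule exp_ge_add_one_self)
    ultimately have "1 \<le> 2 * exp (- (1 / ((norm x)\<^sup>2 - \<rho>\<^sup>2)))" by linarith
    then show ?thesis using s by (simp add: w_def flat_values)
  qed
  ultimately show ?thesis by (rule that)
qed

text \<open>
  Multiplied by a cutoff, the exponential becomes a test function; the cutoff is \<open>1\<close> on a ball
  larger than the one outside of which \<open>u\<close> vanishes, so it changes neither integral.
\<close>
lemma integral_exp_eq_0:
  fixes u :: "'a::euclidean_space \<Rightarrow> real"
  assumes "c \<noteq> 0" and u: "locally_integrable u"
    and weak: "\<And>\<phi>. test_function \<phi> \<Longrightarrow>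
        (LINT x|lebesgue. u x * (- laplacian \<phi> x)) = c\<^sup>2 * (LINT x|lebesgue. u x * \<phi> x)"
    and \<rho>: "AE x in lebesgue. norm x > \<rho> \<longrightarrow> u x = 0"
  shows "(LINT x|lebesgue. u x * exp (\<xi> \<bullet> x)) = 0"
proof -
  obtain \<zeta> :: "'a \<Rightarrow> real" and r where \<zeta>: "smooth \<zeta>"
    "\<And>x. norm x \<le> \<rho> + 1 \<Longrightarrow> \<zeta> x = 1" "\<And>x. r < norm x \<Longrightarrow> \<zeta> x = 0"
    using smooth_cutoff[of "\<rho> + 1"] by blast
  define \<phi> where "\<phi> x = \<zeta> x * exp (\<xi> \<bullet> x)" for x
  have \<phi>: "smooth \<phi>"
    unfolding \<phi>_def by (intro smooth_mult \<zeta> smooth_exp_inner)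
  have eq: "\<phi> x = exp (\<xi> \<bullet> x)" "laplacian \<phi> x = (norm \<xi>)\<^sup>2 * exp (\<xi> \<bullet> x)" if "norm x \<le> \<rho>" for x
  proof -
    show "\<phi> x = exp (\<xi> \<bullet> x)" using that \<zeta>(2)[of x] by (simp add: \<phi>_def)
    have "laplacian \<phi> x = laplacian (\<lambda>x. exp (\<xi> \<bullet> x)) x"
      by (rule laplacian_local[OF open_ball[of 0 "\<rho> + 1"] _ _ \<phi>]) (use that in \<open>auto simp: \<phi>_def \<zeta>\<close>)
    then show "laplacian \<phi> x = (norm \<xi>)\<^sup>2 * exp (\<xi> \<bullet> x)" by (simp add: laplacian_exp_inner)
  qed
  note meas = borel_measurable_times borel_measurable_uminus borel_measurable_const locally_integrable_measurable[OF u]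
    continuous_measurable_lebesgue[OF smooth_continuous[OF \<phi>]]
    continuous_measurable_lebesgue[OF smooth_laplacian_continuous[OF \<phi>]]
    continuous_measurable_lebesgue[OF smooth_continuous[OF smooth_exp_inner[of \<xi>]]]
  have "test_function \<phi>"
    by (rule test_functionI[OF \<phi>, of r 0]) (use \<zeta> in \<open>auto simp: \<phi>_def\<close>)
  from weak[OF this]
  have "(LINT x|lebesgue. u x * (- laplacian \<phi> x)) = c\<^sup>2 * (LINT x|lebesgue. u x * \<phi> x)" .
  also have "(LINT x|lebesgue. u x * \<phi> x) = (LINT x|lebesgue. u x * exp (\<xi> \<bullet> x))"
    by (rule integral_cong_AE, (intro meas)+, rule AE_mp[OF \<rho>], rule AE_I2) (use eq in force)
  also have "(LINT x|lebesgue. u x * (- laplacian \<phi> x)) = (LINT x|lebesgue. - (norm \<xi>)\<^sup>2 * (u x * exp (\<xi> \<bullet> x)))"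
    by (rule integral_cong_AE, (intro meas)+, rule AE_mp[OF \<rho>], rule AE_I2) (use eq in force)
  also have "(LINT x|lebesgue. - (norm \<xi>)\<^sup>2 * (u x * exp (\<xi> \<bullet> x))) =
      - (norm \<xi>)\<^sup>2 * (LINT x|lebesgue. u x * exp (\<xi> \<bullet> x))"
    by (rule integral_mult_right_zero)
  finally have "((norm \<xi>)\<^sup>2 + c\<^sup>2) * (LINT x|lebesgue. u x * exp (\<xi> \<bullet> x)) = 0"
    by (simp add: algebra_simps)
  moreover have "(norm \<xi>)\<^sup>2 + c\<^sup>2 > 0" using \<open>c \<noteq> 0\<close> by (intro add_nonneg_pos) auto
  ultimately show ?thesis using \<open>c \<noteq> 0\<close> by auto
qed

section \<open>Density of the exponentials\<close>

inductive_set exp_span :: "('a::euclidean_space \<Rightarrow> real) set" where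
  scaled_exp: "(\<lambda>x. r * exp (\<xi> \<bullet> x)) \<in> exp_span"
| add: "f \<in> exp_span \<Longrightarrow> g \<in> exp_span \<Longrightarrow> (\<lambda>x. f x + g x) \<in> exp_span"

lemma exp_span_mult:
  assumes "f \<in> exp_span" "g \<in> exp_span"
  shows "(\<lambda>x. f x * g x) \<in> exp_span"
  using assms(1)
proof induction
  case (scaled_exp r \<xi>)
  show ?case using assms(2)
  proof induction
    case (scaled_exp s \<eta>)
    then show ?case
      using exp_span.scaled_exp[of "r * s" "\<xi> + \<eta>"] by (simp add: inner_add_left exp_add algebra_simps)
  qed (auto simp: distrib_left intro: exp_span.add)
qed (auto simp: distrib_right intro: exp_span.add)

lemma exp_span_continuous: "f \<in> exp_span \<Longrightarrow> continuous_on S f"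
  by (induction rule: exp_span.induct) (auto intro!: continuous_intros)

text \<open>
  Two points \<open>x \<noteq> y\<close> are separated by the exponential with \<open>\<xi> = x - y\<close>.
\<close>
lemma exp_span_function_ring:
  assumes "compact S"
  shows "function_ring_on exp_span S"
proof
  show "(\<lambda>_. r) \<in> exp_span" for r
    using exp_span.scaled_exp[of r 0] by simp
  fix x y :: 'a assume "x \<noteq> y"
  then have "(x - y) \<bullet> (x - y) \<noteq> 0" by simp
  then have "(x - y) \<bullet> x \<noteq> (x - y) \<bullet> y" by (simp add: inner_diff_right)
  then show "\<exists>f\<in>exp_span. f x \<noteq> f y"
    by (intro bexI[of _ "\<lambda>z. 1 * exp ((x - y) \<bullet> z)"] exp_span.scaled_exp) simp
qed (use assms in \<open>auto intro: exp_span_continuous exp_span_mult exp_span.add\<close>)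

text \<open>
  By Stone-Weierstrass on the ball outside of which \<open>u\<close> vanishes, the integral of \<open>u g\<close> is zero for
  every continuous \<open>g\<close>. The measurable function \<open>sgn u\<close> is an almost everywhere limit of continuous
  functions, which may be truncated to \<open>[- 1, 1]\<close>; dominated convergence then gives
  \<open>\<integral> \<bar>u\<bar> = 0\<close>.
\<close>
lemma exp_moments_zero_imp_AE_zero:
  fixes u :: "'a::euclidean_space \<Rightarrow> real"
  assumes u: "locally_integrable u" and \<rho>: "AE x in lebesgue. norm x > \<rho> \<longrightarrow> u x = 0"
    and exp0: "\<And>\<xi>. (LINT x|lebesgue. u x * exp (\<xi> \<bullet> x)) = 0"
  shows "AE x in lebesgue. u x = 0"
proof -
  note [measurable] = locally_integrable_measurable[OF u]
  have int: "integrable lebesgue (\<lambda>x. u x * g x)" if "continuous_on UNIV g" for g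
    by (rule integrable_mult_continuous[OF u that compact_cball[of 0 \<rho>]]) (use \<rho> in \<open>auto elim!: AE_mp\<close>)
  have int_u: "integrable lebesgue u"
    using int[of "\<lambda>x. 1"] by simp
  have span0: "(LINT x|lebesgue. u x * f x) = 0" if "f \<in> exp_span" for f
    using that
  proof induction
    case (scaled_exp r \<xi>)
    then show ?case using exp0[of \<xi>] by (simp add: mult.left_commute)
  next
    case (add f g)
    then show ?case
      using int[OF exp_span_continuous[OF add.hyps(1)]] int[OF exp_span_continuous[OF add.hyps(2)]]
      by (simp add: distrib_left)
  qed
  have cont0: "(LINT x|lebesgue. u x * g x) = 0" if g: "continuous_on UNIV g" for g
  proof -
    interpret function_ring_on exp_span "cball 0 \<rho> :: 'a set"
      by (rule exp_span_function_ring) simp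
    have "\<bar>LINT x|lebesgue. u x * g x\<bar> \<le> e * (LINT x|lebesgue. \<bar>u x\<bar>)" if "0 < e" for e
    proof -
      obtain f where f: "f \<in> exp_span" "\<And>x. x \<in> cball 0 \<rho> \<Longrightarrow> \<bar>g x - f x\<bar> < e"
        using Stone_Weierstrass_basic[OF continuous_on_subset[OF g] \<open>0 < e\<close>] by auto
      have "(LINT x|lebesgue. u x * g x) = (LINT x|lebesgue. u x * g x) - (LINT x|lebesgue. u x * f x)"
        using span0 f by simp
      also have "\<dots> = (LINT x|lebesgue. u x * (g x - f x))"
        using int[OF g] int[OF exp_span_continuous[OF f(1)]] by (simp add: right_diff_distrib)
      also have "\<bar>\<dots>\<bar> \<le> (LINT x|lebesgue. \<bar>u x * (g x - f x)\<bar>)"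
        by (rule integral_abs_bound)
      also have "\<dots> \<le> (LINT x|lebesgue. e * \<bar>u x\<bar>)"
      proof (rule integral_mono_AE)
        show "integrable lebesgue (\<lambda>x. \<bar>u x * (g x - f x)\<bar>)"
          by (intro integrable_abs int continuous_intros g exp_span_continuous f)
        show "AE x in lebesgue. \<bar>u x * (g x - f x)\<bar> \<le> e * \<bar>u x\<bar>"
          using \<rho>
        proof eventually_elim
          case (elim x)
          then show ?case
            using mult_right_mono[of "\<bar>g x - f x\<bar>" e "\<bar>u x\<bar>"] f(2)[of x]
            by (cases "norm x \<le> \<rho>") (auto simp: abs_mult mult.commute)
        qed
      qed (use int_u in auto)
      finally show ?thesis by simp
    qed
    note approx = this
    define I where "I = (LINT x|lebesgue. u x * g x)"
    define J where "J = (LINT x|lebesgue. \<bar>u x\<bar>)"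
    have "0 \<le> J" by (simp add: J_def)
    have "I = 0"
    proof (rule ccontr)
      assume "I \<noteq> 0"
      \<comment> \<open>Taking the precision \<open>\<bar>I\<bar> / (J + 1)\<close> instead of \<open>\<bar>I\<bar> / J\<close> makes the estimate strict and covers
        \<open>J = 0\<close>.\<close>
      then have "0 < \<bar>I\<bar> / (J + 1)"
        using \<open>0 \<le> J\<close> by simp
      then have "\<bar>I\<bar> \<le> \<bar>I\<bar> / (J + 1) * J"
        using approx[of "\<bar>I\<bar> / (J + 1)"] by (simp add: I_def J_def)
      also have "\<dots> < \<bar>I\<bar>"
        using \<open>I \<noteq> 0\<close> \<open>0 \<le> J\<close> by (simp add: field_simps)
      finally show False by simp
    qed
    then show ?thesis by (simp add: I_def)
  qed
  have "(\<lambda>x. sgn (u x)) measurable_on UNIV"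
    by (rule lebesgue_measurable_imp_measurable_on) auto
  then obtain N g where N: "negligible N" and g: "\<And>n. continuous_on UNIV (g n)"
    and lim: "\<And>x. x \<notin> N \<Longrightarrow> (\<lambda>n. g n x) \<longlonglongrightarrow> sgn (u x)"
    unfolding measurable_on_def by auto
  define h where "h n x = max (- 1) (min 1 (g n x))" for n x
  have h: "continuous_on UNIV (h n)" for n
    unfolding h_def by (intro continuous_intros g)
  note [measurable] = continuous_measurable_lebesgue[OF h]
  have "(\<lambda>n. LINT x|lebesgue. u x * h n x) \<longlonglongrightarrow> (LINT x|lebesgue. \<bar>u x\<bar>)"
  proof (rule integral_dominated_convergence[where w = "\<lambda>x. \<bar>u x\<bar>"])
    show "AE x in lebesgue. (\<lambda>n. u x * h n x) \<longlonglongrightarrow> \<bar>u x\<bar>"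
      unfolding eventually_ae_filter_negligible
    proof (intro exI[of _ N] conjI N subsetI)
      fix x assume "x \<in> {x. \<not> (\<lambda>n. u x * h n x) \<longlonglongrightarrow> \<bar>u x\<bar>}"
      moreover have "(\<lambda>n. u x * h n x) \<longlonglongrightarrow> u x * max (- 1) (min 1 (sgn (u x)))" if "x \<notin> N"
        unfolding h_def by (intro tendsto_intros lim that)
      moreover have "u x * max (- 1) (min 1 (sgn (u x))) = \<bar>u x\<bar>"
        by (auto simp: sgn_if)
      ultimately show "x \<in> N" by auto
    qed
    have "\<bar>h n x\<bar> \<le> 1" for n x by (auto simp: h_def)
    then have "\<bar>u x\<bar> * \<bar>h n x\<bar> \<le> \<bar>u x\<bar> * 1" for n x by (intro mult_left_mono) auto
    then show "AE x in lebesgue. norm (u x * h n x) \<le> \<bar>u x\<bar>" for n by (simp add: abs_mult)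
  qed (use int_u in auto)
  then have "(LINT x|lebesgue. \<bar>u x\<bar>) = 0"
    using cont0[OF h] by (simp add: LIMSEQ_const_iff)
  then show ?thesis
    using integral_nonneg_eq_0_iff_AE[of lebesgue "\<lambda>x. \<bar>u x\<bar>"] int_u by simp
qed

lemma nonneg_near_infinity_imp_AE_zero:
  fixes u :: "'a::euclidean_space \<Rightarrow> real"
  assumes "c \<noteq> 0" and "locally_integrable u"
    and "\<And>\<phi>. test_function \<phi> \<Longrightarrow>
        (LINT x|lebesgue. u x * (- laplacian \<phi> x)) = c\<^sup>2 * (LINT x|lebesgue. u x * \<phi> x)"
    and "0 < R" "AE x in lebesgue. norm x > R \<longrightarrow> u x \<ge> 0"
  shows "AE x in lebesgue. u x = 0"
proof -
  obtain \<rho> where \<rho>: "AE x in lebesgue. norm x > \<rho> \<longrightarrow> u x = 0"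
    using nonneg_near_infinity_imp_vanishes[OF assms] by auto
  show ?thesis
    by (rule exp_moments_zero_imp_AE_zero[OF assms(2) \<rho> integral_exp_eq_0[OF assms(1-3) \<rho>]])
qed

theorem theorem1p8:
  fixes u :: "real ^ 'n \<Rightarrow> real" and c :: real
  assumes "CARD('n) \<ge> 2"
    and "c \<noteq> 0"
    and "weak_eigenfunction (c\<^sup>2) u"
    and "essentially_bounded u"
  shows "changes_sign_near_infinity u"
proof (rule ccontr)
  assume "\<not> changes_sign_near_infinity u"
  then obtain R where "0 < R" and sign:
    "(AE x in lebesgue. norm x > R \<longrightarrow> u x \<ge> 0) \<or> (AE x in lebesgue. norm x > R \<longrightarrow> u x \<le> 0)"
    by (auto simp: changes_sign_near_infinity_def)
  have u: "locally_integrable u" "\<not> (AE x in lebesgue. u x = 0)"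
    using assms(3) by (auto simp: weak_eigenfunction_def)
  have weak: "(LINT x|lebesgue. u x * (- laplacian \<phi> x)) = c\<^sup>2 * (LINT x|lebesgue. u x * \<phi> x)"
    if "test_function \<phi>" for \<phi>
    using assms(3) that by (auto simp: weak_eigenfunction_def)
  from sign show False
  proof
    assume "AE x in lebesgue. norm x > R \<longrightarrow> u x \<ge> 0"
    from nonneg_near_infinity_imp_AE_zero[OF \<open>c \<noteq> 0\<close> u(1) weak \<open>0 < R\<close> this] u(2) show False
      by blast
  next
    assume "AE x in lebesgue. norm x > R \<longrightarrow> u x \<le> 0"
    then have "AE x in lebesgue. norm x > R \<longrightarrow> - u x \<ge> 0" by simp
    moreover have "locally_integrable (\<lambda>x. - u x)"
      using u(1) by (simp add: locally_integrable_def set_integrable_def)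
    moreover have "(LINT x|lebesgue. - u x * (- laplacian \<phi> x)) = c\<^sup>2 * (LINT x|lebesgue. - u x * \<phi> x)"
      if "test_function \<phi>" for \<phi>
      using weak[OF that] by simp
    ultimately have "AE x in lebesgue. - u x = 0"
      using nonneg_near_infinity_imp_AE_zero[OF \<open>c \<noteq> 0\<close>, of "\<lambda>x. - u x"] \<open>0 < R\<close> by blast
    with u(2) show False by simp
  qed
qed

end
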